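(* For every string $T$ and every LZRR parse $\mathsf{LZRR}(T)$ of $T$, the number of phrases satisfies $|\mathsf{LZRR}(T)|\le|\mathsf{LZ}(T^R)|$, where $T^R$ is the reverse of $T$ and $\mathsf{LZ}(\cdot)$ is the LZ77 parse.
   Context: Let $T=T[1]\cdots T[n]$ be a string over an ordered alphabet $\Sigma$ (elements of $\Sigma$ regarded as distinct from integers); $T^R=T[n]T[n-1]\cdots T[1]$. $T[a..b]$ is a substring, $T[a..]=T[a..n]$, and $\mathsf{lcp}(a,b)$ is the length of the longest common prefix of $T[a..]$ and $T[b..]$. LZ77 parse: for a string $S$ of length $n$, let $\mathsf{LPF}[1]=0$ and $\mathsf{LPF}[s]=\max\{\mathsf{lcp}(s,p):1\le p<s\}$ (lcp taken in $S$). $\mathsf{LZ}(S)=f_1,\dots,f_z$ is the partition of $S$ into consecutive phrases with $s_1=1$, $s_{x+1}=s_x+|f_x|$ and $|f_x|=\max\{1,\mathsf{LPF}[s_x]\}$; $|\mathsf{LZ}(S)|=z$. A bidirectional parse (BP) of $T$ is a sequence of phrases $f_1,\dots,f_b$ partitioning $T$, with $f_x=T[s_x..s_x+|f_x|-1]$, $s_1=1$, $s_{x+1}=s_x+|f_x|$, $s_{b+1}=n+1$; each phrase is a character phrase ($|f_x|=1$, storing $T[s_x]$) or a target phrase $\langle t_x,|f_x|\rangle$ with $t_x\ne s_x$, $t_x+|f_x|-1\le n$, $T[t_x..t_x+|f_x|-1]=T[s_x..s_x+|f_x|-1]$. Define $g^0(x)=T[x]$ if $x$ lies in a character phrase and $g^0(x)=t_p+(x-s_p)$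 if $x$ lies in target phrase $f_p$; $g^k(x)=g^{k-1}(x)$ if $g^{k-1}(x)\in\Sigma$, else $g^k(x)=g^0(g^{k-1}(x))$. The BP is valid if $g^n(x)\in\Sigma$ for all $x$. A partial bidirectional parse (PBP) $P$ is such a sequence of phrases partitioning only a prefix $T[1..m]$ (references anywhere in $\{1,\dots,n\}$ other than the phrase's own start); $i=m+1$ is the position following $P$; $B_P$ is $P$ followed by the character phrases $T[m+1],\dots,T[n]$; $P$ is valid if $B_P$ is valid; $P\cdot f$ appends phrase $f$. For a valid PBP $P$ with following position $i\le n$ and $j\in\{1,\dots,n\}$: $\mathsf{LF}(P,j)=\max(\{0\}\cup\{\ell\in\{1,\dots,\mathsf{lcp}(i,j)\}:P\cdot\langle j,\ell\rangle\text{ is a valid PBP}\})$. With $M=\max_j\mathsf{LF}(P,j)$, $\mathsf{LP}(P)$ is $\langle j^*,M\rangle$ for some $j^*$ with $\mathsf{LF}(P,j^* )=M$ if $M>0$, and the character phrase $T[i]$ otherwise. An LZRR parse $\mathsf{LZRR}(T)=f_1,\dots,f_b$ is obtained by $P_0=$ empty, $f_{p+1}=\mathsf{LP}(P_p)$, $P_{p+1}=P_p\cdot f_{p+1}$, until $P_b$ covers $T$; $|\mathsf{LZRR}(T)|=b$. *)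

theory Defs
  imports Main "HOL-Library.Sublist"
begin

text \<open>
  Positions in a string are 1-based, while the phrases of a parse form a list and are
  indexed from 0: \<open>P ! x\<close> is the (\<open>x + 1\<close>)-st phrase.
\<close>

definition char_at :: "'a list \<Rightarrow> nat \<Rightarrow> 'a" where
  "char_at T i = T ! (i - 1)"

definition substr :: "'a list \<Rightarrow> nat \<Rightarrow> nat \<Rightarrow> 'a list" where
  "substr T a b = take (b + 1 - a) (drop (a - 1) T)"

definition suffix_from :: "'a list \<Rightarrow> nat \<Rightarrow> 'a list" where
  "suffix_from T a = substr T a (length T)"

definition lcp :: "'a list \<Rightarrow> nat \<Rightarrow> nat \<Rightarrow> nat" where
  "lcp T a b = length (longest_common_prefix (suffix_from T a) (suffix_from T b))"

definition LPF :: "'a list \<Rightarrow> nat \<Rightarrow> nat" where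
  "LPF S s = (if s = 1 then 0 else Max {lcp S s p | p. 1 \<le> p \<and> p < s})"

definition lz_len :: "'a list \<Rightarrow> nat \<Rightarrow> nat" where
  "lz_len S s = max 1 (LPF S s)"

function LZ_from :: "'a list \<Rightarrow> nat \<Rightarrow> 'a list list" where
  "LZ_from S s =
     (if s \<le> length S
      then substr S s (s + lz_len S s - 1) # LZ_from S (s + lz_len S s)
      else [])"
  by pat_completeness auto
termination
  by (relation "measure (\<lambda>(S, s). length S + 1 - s)") (auto simp: lz_len_def)

declare LZ_from.simps [simp del]

definition LZ :: "'a list \<Rightarrow> 'a list list" where
  "LZ S = LZ_from S 1"

datatype 'a phrase = Character 'a | Target nat nat

fun phrase_len :: "'a phrase \<Rightarrow> nat" where
  "phrase_len (Character c) = 1"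
| "phrase_len (Target t l) = l"

definition parse_len :: "'a phrase list \<Rightarrow> nat" where
  "parse_len P = sum_list (map phrase_len P)"

definition phrase_start :: "'a phrase list \<Rightarrow> nat \<Rightarrow> nat" where
  "phrase_start P x = 1 + parse_len (take x P)"

definition next_pos :: "'a phrase list \<Rightarrow> nat" where
  "next_pos P = parse_len P + 1"

fun phrase_ok :: "'a list \<Rightarrow> nat \<Rightarrow> 'a phrase \<Rightarrow> bool" where
  "phrase_ok T s (Character c) \<longleftrightarrow> c = char_at T s"
| "phrase_ok T s (Target t l) \<longleftrightarrow>
     1 \<le> l \<and> 1 \<le> t \<and> t \<noteq> s \<and> t + l - 1 \<le> length T \<and>
     substr T t (t + l - 1) = substr T s (s + l - 1)"

definition is_PBP :: "'a list \<Rightarrow> 'a phrase list \<Rightarrow> bool" where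
  "is_PBP T P \<longleftrightarrow>
     parse_len P \<le> length T \<and> (\<forall>x<length P. phrase_ok T (phrase_start P x) (P ! x))"

definition is_BP :: "'a list \<Rightarrow> 'a phrase list \<Rightarrow> bool" where
  "is_BP T B \<longleftrightarrow> is_PBP T B \<and> parse_len B = length T"

definition phrase_at :: "'a phrase list \<Rightarrow> nat \<Rightarrow> nat" where
  "phrase_at B x = (THE p. p < length B \<and> phrase_start B p \<le> x \<and>
                           x < phrase_start B p + phrase_len (B ! p))"

text \<open>
  The values of the reference maps lie in the disjoint union of the alphabet (\<open>Inl\<close>)
  and the positions (\<open>Inr\<close>).
\<close>

definition g0 :: "'a list \<Rightarrow> 'a phrase list \<Rightarrow> nat \<Rightarrow> 'a + nat" where
  "g0 T B x =
     (let p = phrase_at B x in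
      case B ! p of
        Character c \<Rightarrow> Inl (char_at T x)
      | Target t l \<Rightarrow> Inr (t + (x - phrase_start B p)))"

fun g :: "'a list \<Rightarrow> 'a phrase list \<Rightarrow> nat \<Rightarrow> nat \<Rightarrow> 'a + nat" where
  "g T B 0 x = g0 T B x"
| "g T B (Suc k) x = (case g T B k x of Inl c \<Rightarrow> Inl c | Inr y \<Rightarrow> g0 T B y)"

definition valid_BP :: "'a list \<Rightarrow> 'a phrase list \<Rightarrow> bool" where
  "valid_BP T B \<longleftrightarrow> is_BP T B \<and> (\<forall>x\<in>{1..length T}. isl (g T B (length T) x))"

definition completion :: "'a list \<Rightarrow> 'a phrase list \<Rightarrow> 'a phrase list" where
  "completion T P = P @ map Character (suffix_from T (next_pos P))"

definition valid_PBP :: "'a list \<Rightarrow> 'a phrase list \<Rightarrow> bool" where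
  "valid_PBP T P \<longleftrightarrow> is_PBP T P \<and> valid_BP T (completion T P)"

definition LF :: "'a list \<Rightarrow> 'a phrase list \<Rightarrow> nat \<Rightarrow> nat" where
  "LF T P j =
     Max ({0} \<union> {l \<in> {1..lcp T (next_pos P) j}. valid_PBP T (P @ [Target j l])})"

definition max_LF :: "'a list \<Rightarrow> 'a phrase list \<Rightarrow> nat" where
  "max_LF T P = Max (LF T P ` {1..length T})"

text \<open>
  The longest next phrase is determined only up to the choice of a source position that
  attains the maximum, so it is given as a relation, as are the parses built from it.
\<close>

definition is_LP :: "'a list \<Rightarrow> 'a phrase list \<Rightarrow> 'a phrase \<Rightarrow> bool" where
  "is_LP T P f \<longleftrightarrow>
     (if max_LF T P > 0
      then \<exists>j\<in>{1..length T}. LF T P j = max_LF T P \<and> f = Target j (max_LF T P)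
      else f = Character (char_at T (next_pos P)))"

inductive LZRR_partial :: "'a list \<Rightarrow> 'a phrase list \<Rightarrow> bool" for T where
  empty: "LZRR_partial T []"
| step: "LZRR_partial T P \<Longrightarrow> next_pos P \<le> length T \<Longrightarrow> is_LP T P f \<Longrightarrow> LZRR_partial T (P @ [f])"

definition is_LZRR :: "'a list \<Rightarrow> 'a phrase list \<Rightarrow> bool" where
  "is_LZRR T F \<longleftrightarrow> LZRR_partial T F \<and> parse_len F = length T"

end

theory Submission
  imports Defs
begin

text \<open>
  Read from right to left, every phrase of the LZ77 parse of the reversed string is a
  single character or an interval of \<open>T\<close> with a further occurrence to its right, and the
  same then holds for each suffix of the interval. Appending to a valid partial parse a
  phrase that refers to the right never creates a cycle: the new references increase until
  they leave the phrase, and everything behind it is still a character. Hence an LZRR phrase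
  that starts inside such an interval reaches at least its end, so that each interval
  contains the start of at most one LZRR phrase.
\<close>

section \<open>Common prefixes\<close>

lemma substr_rev:
  assumes "1 \<le> a" "b \<le> length T"
  shows "substr (rev T) a b = rev (substr T (length T + 1 - b) (length T + 1 - a))"
  using assms by (cases "a \<le> b") (simp_all add: substr_def drop_rev take_rev drop_take)

lemma le_length_longest_common_prefix_iff:
  "m \<le> length (longest_common_prefix xs ys) \<longleftrightarrow>
     m \<le> length xs \<and> m \<le> length ys \<and> take m xs = take m ys"
proof (induction xs ys arbitrary: m rule: longest_common_prefix.induct)
  case (1 x xs y ys)
  then show ?case by (cases m) auto
qed auto

lemma le_lcp_iff:
  assumes "1 \<le> a" "1 \<le> b" "1 \<le> m"
  shows "m \<le> lcp T a b \<longleftrightarrow> a + m \<le> length T + 1 \<and> b + m \<le> length T + 1 \<and>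
    substr T a (a + m - 1) = substr T b (b + m - 1)"
  using assms
  by (auto simp: lcp_def suffix_from_def substr_def le_length_longest_common_prefix_iff)

lemma le_lcp_rev:
  assumes "1 \<le> a" "1 \<le> b" "1 \<le> m" "m \<le> lcp (rev T) a b"
  shows "m \<le> lcp T (length T + 2 - a - m) (length T + 2 - b - m)"
proof -
  have bounds: "a + m \<le> length T + 1" "b + m \<le> length T + 1"
    and "substr (rev T) a (a + m - 1) = substr (rev T) b (b + m - 1)"
    using assms le_lcp_iff[of a b m "rev T"] by simp_all
  then have "substr T (length T + 2 - a - m) (length T + 1 - a) =
      substr T (length T + 2 - b - m) (length T + 1 - b)"
    using assms by (simp add: substr_rev)
  then show ?thesis using assms bounds by (subst le_lcp_iff) (simp_all, arith)
qed

lemma le_lz_len_iff: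
  assumes "1 \<le> s" "2 \<le> m"
  shows "m \<le> lz_len S s \<longleftrightarrow> (\<exists>p. 1 \<le> p \<and> p < s \<and> m \<le> lcp S s p)"
proof (cases "s = 1")
  case False
  then have "{lcp S s p | p. 1 \<le> p \<and> p < s} \<noteq> {}"
    using assms by (auto intro!: exI[of _ 1])
  then have "m \<le> LPF S s \<longleftrightarrow> (\<exists>p. 1 \<le> p \<and> p < s \<and> m \<le> lcp S s p)"
    using False by (auto simp: LPF_def Max_ge_iff)
  then show ?thesis using assms by (simp add: lz_len_def le_max_iff_disj)
qed (use assms in \<open>auto simp: lz_len_def LPF_def\<close>)

lemma lz_len_rev_right_occurrence:
  assumes "1 \<le> s" "2 \<le> m" "m \<le> lz_len (rev T) s"
  obtains j where "length T + 2 - s - m < j" "m \<le> lcp T (length T + 2 - s - m) j"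
proof -
  obtain p where p: "1 \<le> p" "p < s" "m \<le> lcp (rev T) s p"
    using assms le_lz_len_iff by blast
  then have "m \<le> lcp T (length T + 2 - s - m) (length T + 2 - p - m)"
    using assms by (intro le_lcp_rev) simp_all
  moreover have "s + m \<le> length T + 1"
    using assms p le_lcp_iff[of s p m "rev T"] by simp
  ultimately show thesis using p(2) by (intro that) simp_all
qed

section \<open>Phrases and references\<close>

lemma parse_len_simps [simp]:
  "parse_len [] = 0"
  "parse_len (f # P) = phrase_len f + parse_len P"
  "parse_len (P @ Q) = parse_len P + parse_len Q"
  "parse_len (map Character cs) = length cs"
  by (simp_all add: parse_len_def comp_def sum_list_triv)

lemma phrase_start_Suc:
  "x < length B \<Longrightarrow> phrase_start B (Suc x) = phrase_start B x + phrase_len (B ! x)"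
  by (simp add: phrase_start_def take_Suc_conv_app_nth)

lemma phrase_start_mono:
  assumes "x \<le> y"
  shows "phrase_start B x \<le> phrase_start B y"
proof -
  have "take y B = take x B @ take (y - x) (drop x B)"
    using assms take_add[of x "y - x" B] by simp
  then show ?thesis by (simp add: phrase_start_def)
qed

lemma phrase_start_append_length: "phrase_start (P @ Q) (length P) = next_pos P"
  by (simp add: phrase_start_def next_pos_def)

lemma phrase_at_append_Cons:
  assumes "parse_len P < x" "x \<le> parse_len P + phrase_len f"
  shows "phrase_at (P @ f # Q) x = length P"
  unfolding phrase_at_def
proof (rule the_equality)
  let ?B = "P @ f # Q"
  have start: "phrase_start ?B (length P) \<le> x"
      "x < phrase_start ?B (length P) + phrase_len (?B ! length P)"
    using assms by (simp_all add: phrase_start_append_length next_pos_def)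
  then show "length P < length ?B \<and> phrase_start ?B (length P) \<le> x \<and>
      x < phrase_start ?B (length P) + phrase_len (?B ! length P)" by simp
  fix q
  assume "q < length ?B \<and> phrase_start ?B q \<le> x \<and> x < phrase_start ?B q + phrase_len (?B ! q)"
  then show "q = length P"
    using start phrase_start_mono[of "Suc q" "length P" ?B]
      phrase_start_mono[of "Suc (length P)" q ?B]
    by (cases q "length P" rule: linorder_cases) (simp_all add: phrase_start_Suc)
qed

lemma g0_append_Cons:
  assumes "parse_len P < x" "x \<le> parse_len P + phrase_len f"
  shows "g0 T (P @ f # Q) x =
    (case f of Character c \<Rightarrow> Inl (char_at T x) | Target t l \<Rightarrow> Inr (t + (x - next_pos P)))"
  by (simp add: g0_def phrase_at_append_Cons[OF assms] phrase_start_append_length split: phrase.split)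

lemma parse_split_at:
  assumes "1 \<le> x" "x \<le> parse_len B"
  obtains P f Q where "B = P @ f # Q" "parse_len P < x" "x \<le> parse_len P + phrase_len f"
  using assms
proof (induction B arbitrary: thesis rule: rev_induct)
  case (snoc f B)
  show ?case
  proof (cases "x \<le> parse_len B")
    case True
    then obtain P h Q where "B = P @ h # Q" "parse_len P < x" "x \<le> parse_len P + phrase_len h"
      using snoc.IH snoc.prems(2) by blast
    then show ?thesis using snoc.prems(1)[of P h "Q @ [f]"] by simp
  next
    case False
    then show ?thesis using snoc.prems(1)[of B f "[]"] snoc.prems(3) by simp
  qed
qed simp

lemma g0_append:
  assumes "1 \<le> x" "x \<le> parse_len P"
  shows "g0 T (P @ Q) x = g0 T P x"
proof -
  obtain P\<^sub>1 f P\<^sub>2 where "P = P\<^sub>1 @ f # P\<^sub>2" "parse_len P\<^sub>1 < x" "x \<le> parse_len P\<^sub>1 + phrase_len f"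
    using parse_split_at assms by blast
  then show ?thesis by (simp add: g0_append_Cons)
qed

lemma g0_completion_left:
  "1 \<le> x \<Longrightarrow> x \<le> parse_len P \<Longrightarrow> g0 T (completion T P) x = g0 T P x"
  by (simp add: completion_def g0_append)

lemma completion_eq: "completion T P = P @ map Character (drop (parse_len P) T)"
  by (simp add: completion_def next_pos_def suffix_from_def substr_def)

lemma g0_completion_right:
  assumes "parse_len P < x" "x \<le> length T"
  shows "g0 T (completion T P) x = Inl (char_at T x)"
proof -
  define R where "R = map Character (drop (parse_len P) T)"
  have "1 \<le> x - parse_len P" "x - parse_len P \<le> parse_len R" using assms by (simp_all add: R_def)
  then obtain P\<^sub>1 f P\<^sub>2 where split: "R = P\<^sub>1 @ f # P\<^sub>2"
    and x: "parse_len P\<^sub>1 < x - parse_len P" "x - parse_len P \<le> parse_len P\<^sub>1 + phrase_len f"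
    using parse_split_at by blast
  have "f \<in> set R" using split by simp
  then obtain c where "f = Character c" by (auto simp: R_def)
  moreover have "completion T P = (P @ P\<^sub>1) @ f # P\<^sub>2" using split by (simp add: completion_eq R_def)
  ultimately show ?thesis using x g0_append_Cons[of "P @ P\<^sub>1" x f T P\<^sub>2] by simp
qed

lemma completion_snoc_Character:
  assumes "parse_len P < length T"
  shows "completion T (P @ [Character (char_at T (next_pos P))]) = completion T P"
  by (simp add: completion_eq next_pos_def char_at_def Cons_nth_drop_Suc[OF assms, symmetric])

lemma is_PBP_snoc_iff:
  "is_PBP T (P @ [f]) \<longleftrightarrow>
     is_PBP T P \<and> parse_len P + phrase_len f \<le> length T \<and> phrase_ok T (next_pos P) f"
  by (auto simp: is_PBP_def less_Suc_eq nth_append phrase_start_def next_pos_def)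

lemma phrase_ok_if_is_PBP_append_Cons:
  assumes "is_PBP T (P @ f # Q)"
  shows "phrase_ok T (next_pos P) f"
  using assms phrase_start_append_length[of P "f # Q"]
  by (auto simp: is_PBP_def dest!: spec[of _ "length P"])

lemma phrase_ok_Target_iff:
  assumes "1 \<le> s" "s + l \<le> length T + 1"
  shows "phrase_ok T s (Target t l) \<longleftrightarrow> 1 \<le> l \<and> 1 \<le> t \<and> t \<noteq> s \<and> l \<le> lcp T s t"
  using assms le_lcp_iff[of s t l T] by auto

lemma is_PBP_snoc_Target_iff:
  "is_PBP T (P @ [Target t l]) \<longleftrightarrow>
     is_PBP T P \<and> 1 \<le> l \<and> 1 \<le> t \<and> t \<noteq> next_pos P \<and> l \<le> lcp T (next_pos P) t"
  using phrase_ok_Target_iff[of "next_pos P" l T t] le_lcp_iff[of "next_pos P" t l T]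
  by (auto simp: is_PBP_snoc_iff next_pos_def simp del: phrase_ok.simps)

lemma is_BP_completion:
  assumes "is_PBP T P"
  shows "is_BP T (completion T P)"
  using assms
proof (induction "length T - parse_len P" arbitrary: P rule: less_induct)
  case less
  show ?case
  proof (cases "parse_len P < length T")
    case True
    let ?P' = "P @ [Character (char_at T (next_pos P))]"
    have "is_PBP T ?P'" using less.prems True by (simp add: is_PBP_snoc_iff)
    then have "is_BP T (completion T ?P')" using less.hyps[of ?P'] True by simp
    then show ?thesis using True by (simp add: completion_snoc_Character)
  next
    case False
    then show ?thesis using less.prems by (simp add: completion_eq is_BP_def is_PBP_def)
  qed
qed

lemma g0_Inr_in_range:
  assumes B: "is_BP T B" and x: "x \<in> {1..length T}" and g0: "g0 T B x = Inr y"
  shows "y \<in> {1..length T}"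
proof -
  obtain P f Q where split: "B = P @ f # Q" "parse_len P < x" "x \<le> parse_len P + phrase_len f"
    using parse_split_at[of x B] B x by (auto simp: is_BP_def)
  then obtain t l where f: "f = Target t l" and y: "y = t + (x - next_pos P)"
    using g0 by (auto simp: g0_append_Cons split: phrase.splits)
  have "phrase_ok T (next_pos P) f"
    using B split by (intro phrase_ok_if_is_PBP_append_Cons[of T P f Q]) (simp add: is_BP_def)
  then show ?thesis using f y split by (auto simp: next_pos_def)
qed

section \<open>Termination of references\<close>

inductive resolves :: "('p \<Rightarrow> 'c + 'p) \<Rightarrow> 'p \<Rightarrow> bool" for h where
  halt: "h x = Inl c \<Longrightarrow> resolves h x"
| follow: "h x = Inr y \<Longrightarrow> resolves h y \<Longrightarrow> resolves h x"

lemma resolves_if_references_increase: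
  fixes h :: "nat \<Rightarrow> 'c + nat"
  assumes increase: "\<And>x y. m < x \<Longrightarrow> x \<le> n \<Longrightarrow> h x = Inr y \<Longrightarrow> x < y \<and> y \<le> n"
    and "m < x" "x \<le> n"
  shows "resolves h x"
  using assms(2,3)
proof (induction "n - x" arbitrary: x rule: less_induct)
  case less
  show ?case
  proof (cases "h x")
    case (Inl c)
    then show ?thesis by (rule resolves.halt)
  next
    case (Inr y)
    then have "x < y" "y \<le> n" using increase less.prems by blast+
    then have "resolves h y" using less by simp
    with Inr show ?thesis by (rule resolves.follow)
  qed
qed

lemma resolves_transfer:
  assumes "resolves h x" "x \<in> A"
    and closed: "\<And>x y. x \<in> A \<Longrightarrow> h x = Inr y \<Longrightarrow> y \<in> A"
    and agree: "\<And>x. x \<in> A \<Longrightarrow> h' x = h x \<or> resolves h' x"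
  shows "resolves h' x"
  using assms(1,2)
proof (induction rule: resolves.induct)
  case (halt x c)
  then show ?case using agree[of x] by (auto intro: resolves.halt)
next
  case (follow x y)
  then show ?case using agree[of x] closed[of x y] by (auto intro: resolves.follow)
qed

lemma g_Suc_front: "g T B (Suc k) x = (case g0 T B x of Inl c \<Rightarrow> Inl c | Inr y \<Rightarrow> g T B k y)"
  by (induction k) (auto split: sum.splits)

lemma resolves_iff_ex_isl_g: "resolves (g0 T B) x \<longleftrightarrow> (\<exists>k. isl (g T B k x))"
proof
  assume "resolves (g0 T B) x"
  then show "\<exists>k. isl (g T B k x)"
  proof (induction rule: resolves.induct)
    case (halt x c)
    then have "isl (g T B 0 x)" by simp
    then show ?case ..
  next
    case (follow x y)
    then obtain k where "isl (g T B k y)" by blast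
    then have "isl (g T B (Suc k) x)" using follow.hyps(1) by (simp only: g_Suc_front sum.case)
    then show ?case ..
  qed
next
  assume "\<exists>k. isl (g T B k x)"
  then obtain k where "isl (g T B k x)" ..
  then show "resolves (g0 T B) x"
  proof (induction k arbitrary: x)
    case 0
    then show ?case by (auto simp: isl_def intro: resolves.halt)
  next
    case (Suc k)
    then show ?case
      by (cases "g0 T B x") (auto simp only: g_Suc_front sum.case intro: resolves.intros)
  qed
qed

lemma isl_g_length_iff_resolves:
  assumes B: "is_BP T B" and x: "x \<in> {1..length T}"
  shows "isl (g T B (length T) x) \<longleftrightarrow> resolves (g0 T B) x"
proof -
  define R where "R k = {x \<in> {1..length T}. isl (g T B k x)}" for k
  define step where "step A = {x \<in> {1..length T}. \<forall>y. g0 T B x = Inr y \<longrightarrow> y \<in> A}" for A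
  have R_Suc: "R (Suc k) = step (R k)" for k
  proof -
    have "isl (g T B (Suc k) x) \<longleftrightarrow> (\<forall>y. g0 T B x = Inr y \<longrightarrow> y \<in> R k)"
      if "x \<in> {1..length T}" for x
      using g0_Inr_in_range[OF B that]
      by (cases "g0 T B x") (auto simp add: g_Suc_front R_def simp del: g.simps)
    then show ?thesis unfolding R_def[of "Suc k"] step_def by blast
  qed
  have "mono R"
    unfolding mono_iff_le_Suc by (auto simp: R_def isl_def)
  moreover have "finite (range R)"
    by (rule finite_subset[of _ "Pow {1..length T}"]) (auto simp: R_def)
  moreover have "\<forall>k. R k = R (Suc k) \<longrightarrow> R (Suc k) = R (Suc (Suc k))"
    by (metis R_Suc)
  ultimately have "\<exists>N. (\<forall>n\<le>N. \<forall>m\<le>N. m < n \<longrightarrow> R m \<subset> R n) \<and> (\<forall>n\<ge>N. R N = R n)"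
    by (intro finite_mono_remains_stable_implies_strict_prefix)
  then have "R (card {1..length T}) = (\<Union>k. R k)"
    by (intro finite_mono_strict_prefix_implies_finite_fixpoint) (auto simp: R_def)
  then show ?thesis using x by (auto simp: R_def resolves_iff_ex_isl_g)
qed

lemma valid_BP_iff_resolves:
  "valid_BP T B \<longleftrightarrow> is_BP T B \<and> (\<forall>x\<in>{1..length T}. resolves (g0 T B) x)"
  by (auto simp: valid_BP_def isl_g_length_iff_resolves)

lemma valid_PBP_iff_resolves:
  "valid_PBP T P \<longleftrightarrow> is_PBP T P \<and> (\<forall>x\<in>{1..length T}. resolves (g0 T (completion T P)) x)"
  using is_BP_completion by (auto simp: valid_PBP_def valid_BP_iff_resolves)

section \<open>Valid extensions\<close>

lemma valid_PBP_Nil: "valid_PBP T []"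
  by (auto simp: valid_PBP_iff_resolves is_PBP_def intro!: resolves.halt g0_completion_right)

lemma valid_PBP_snoc_Character:
  assumes "valid_PBP T P" "next_pos P \<le> length T"
  shows "valid_PBP T (P @ [Character (char_at T (next_pos P))])"
  using assms completion_snoc_Character[of P T]
  by (simp add: valid_PBP_def is_PBP_snoc_iff next_pos_def)

lemma g0_completion_snoc_Target_right:
  assumes "next_pos P < j" "parse_len P < x" "x \<le> length T"
    and g0: "g0 T (completion T (P @ [Target j l])) x = Inr y"
  shows "x < y"
proof (cases "x \<le> parse_len P + l")
  case True
  then have "g0 T (completion T (P @ [Target j l])) x = Inr (j + (x - next_pos P))"
    using assms(2) by (simp add: completion_def g0_append_Cons)
  then show ?thesis using g0 assms(1,2) by (simp add: next_pos_def)
next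
  case False
  then show ?thesis using g0 assms(3) g0_completion_right[of "P @ [Target j l]" x T] by simp
qed

lemma valid_PBP_snoc_right_Target:
  assumes P: "valid_PBP T P" and j: "next_pos P < j"
    and l: "1 \<le> l" "l \<le> lcp T (next_pos P) j"
  shows "valid_PBP T (P @ [Target j l])"
proof -
  define B B' where "B = completion T P" and "B' = completion T (P @ [Target j l])"
  have PBP: "is_PBP T (P @ [Target j l])"
    using P j l by (simp add: is_PBP_snoc_Target_iff valid_PBP_def)
  have right: "resolves (g0 T B') x" if "parse_len P < x" "x \<le> length T" for x
  proof (rule resolves_if_references_increase[OF _ that])
    fix x y
    assume x: "parse_len P < x" "x \<le> length T" "g0 T B' x = Inr y"
    then have "x < y"
      unfolding B'_def by (rule g0_completion_snoc_Target_right[OF j])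
    moreover have "y \<in> {1..length T}"
      using x g0_Inr_in_range[OF is_BP_completion[OF PBP], of x y] by (simp add: B'_def)
    ultimately show "x < y \<and> y \<le> length T" by simp
  qed
  have left: "g0 T B' x = g0 T B x" if "1 \<le> x" "x \<le> parse_len P" for x
    using that by (simp add: B_def B'_def g0_completion_left g0_append)
  have "resolves (g0 T B') x" if "x \<in> {1..length T}" for x
  proof (rule resolves_transfer[of "g0 T B" x "{1..length T}"])
    show "resolves (g0 T B) x" using P that by (simp add: valid_PBP_iff_resolves B_def)
    show "z \<in> {1..length T}" if "y \<in> {1..length T}" "g0 T B y = Inr z" for y z
      using P that g0_Inr_in_range by (auto simp: valid_PBP_def valid_BP_def B_def)
    show "g0 T B' y = g0 T B y \<or> resolves (g0 T B') y" if "y \<in> {1..length T}" for y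
      using that left right by (cases "y \<le> parse_len P") auto
  qed (rule that)
  then show ?thesis using PBP by (simp add: valid_PBP_iff_resolves B'_def)
qed

section \<open>Greedy phrases\<close>

lemma le_LF_if_valid_PBP:
  assumes "valid_PBP T (P @ [Target j l])"
  shows "l \<le> LF T P j"
  unfolding LF_def using assms
  by (intro Max_ge) (auto simp: valid_PBP_def is_PBP_snoc_Target_iff)

lemma valid_PBP_snoc_LF:
  assumes "0 < LF T P j"
  shows "valid_PBP T (P @ [Target j (LF T P j)])"
proof -
  have "LF T P j \<in> {0} \<union> {l \<in> {1..lcp T (next_pos P) j}. valid_PBP T (P @ [Target j l])}"
    unfolding LF_def by (intro Max_in) auto
  then show ?thesis using assms by simp
qed

lemma is_LP_phrase_len_ge_1: "is_LP T P f \<Longrightarrow> 1 \<le> phrase_len f"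
  by (auto simp: is_LP_def split: if_splits)

lemma is_LP_phrase_len_maximal:
  assumes LP: "is_LP T P f" and valid: "valid_PBP T (P @ [Target j l])"
  shows "l \<le> phrase_len f"
proof -
  have l: "1 \<le> l" and "j \<in> {1..length T}"
    using valid le_lcp_iff[of "next_pos P" j l T]
    by (auto simp: valid_PBP_def is_PBP_snoc_Target_iff next_pos_def)
  then have "LF T P j \<le> max_LF T P" unfolding max_LF_def by (intro Max_ge) auto
  then have "l \<le> max_LF T P" using le_LF_if_valid_PBP[OF valid] by simp
  then show ?thesis using LP l by (auto simp: is_LP_def)
qed

lemma valid_PBP_snoc_is_LP:
  assumes "valid_PBP T P" "next_pos P \<le> length T" "is_LP T P f"
  shows "valid_PBP T (P @ [f])"
proof (cases "max_LF T P > 0")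
  case True
  then obtain j where "LF T P j = max_LF T P" "f = Target j (max_LF T P)"
    using assms(3) by (auto simp: is_LP_def)
  then show ?thesis using True valid_PBP_snoc_LF[of T P j] by simp
next
  case False
  then show ?thesis using assms valid_PBP_snoc_Character by (simp add: is_LP_def)
qed

lemma LZRR_partial_imp_valid: "LZRR_partial T P \<Longrightarrow> valid_PBP T P"
  by (induction rule: LZRR_partial.induct) (auto intro: valid_PBP_Nil valid_PBP_snoc_is_LP)

lemma is_LP_reaches_end_of_reversed_LZ_phrase:
  assumes P: "valid_PBP T P" and f: "is_LP T P f" and s: "1 \<le> s" "parse_len P + s \<le> length T"
    and inside: "length T < parse_len P + s + lz_len (rev T) s"
  shows "length T < parse_len (P @ [f]) + s"
proof -
  define m where "m = length T + 1 - s - parse_len P"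
  have m: "1 \<le> m" "m \<le> lz_len (rev T) s" and next_pos: "length T + 2 - s - m = next_pos P"
    using s inside by (simp_all add: m_def next_pos_def)
  have "m \<le> phrase_len f"
  proof (cases "m = 1")
    case True
    then show ?thesis using is_LP_phrase_len_ge_1[OF f] by simp
  next
    case False
    then obtain j where "next_pos P < j" "m \<le> lcp T (next_pos P) j"
      using lz_len_rev_right_occurrence[of s m T] s(1) m unfolding next_pos by auto
    then show ?thesis
      using P m(1) by (intro is_LP_phrase_len_maximal[OF f] valid_PBP_snoc_right_Target)
  qed
  then show ?thesis using s(2) by (simp add: m_def)
qed

lemma length_LZRR_partial_less_LZ_from:
  assumes "LZRR_partial T P" "1 \<le> s" "parse_len P + s \<le> length T"
  shows "length P < length (LZ_from (rev T) s)"
  using assms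
proof (induction arbitrary: s rule: LZRR_partial.induct)
  case empty
  then show ?case by (subst LZ_from.simps) simp
next
  case (step P f)
  define s' where "s' = s + lz_len (rev T) s"
  have "parse_len P + s' \<le> length T"
    using is_LP_reaches_end_of_reversed_LZ_phrase[OF LZRR_partial_imp_valid] step
    by (fastforce simp: s'_def)
  then have "length P < length (LZ_from (rev T) s')"
    using step.IH step.prems(1) by (simp add: s'_def)
  then show ?case using step.prems(2) by (subst LZ_from.simps) (simp add: s'_def)
qed

theorem theorem2:
  fixes T :: "'a::linorder list" and F :: "'a phrase list"
  assumes "is_LZRR T F"
  shows "length F \<le> length (LZ (rev T))"
proof -
  have "LZRR_partial T F" using assms by (simp add: is_LZRR_def)
  then show ?thesis
  proof cases
    case (step P f)
    then have "length P < length (LZ_from (rev T) 1)"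
      by (intro length_LZRR_partial_less_LZ_from) (simp_all add: next_pos_def)
    then show ?thesis using step(1) by (simp add: LZ_def)
  qed simp
qed

end
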